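(* Let $\Sigma$ and $\Delta$ be graded posets and $\varphi:\Sigma\to\Delta$ a combinatorial morphism. Let $d=\dim\Sigma$, let $\mathcal V=\uparrow_\Sigma\Sigma(d-1)$, and let $m_{\mathcal V}:\mathcal V\to\mathbb Z_{\ge1}$ be a balanced map. If $\Delta$ is strongly connected, then $m_{\mathcal V}$ extends to a balanced map $m_\Sigma:\Sigma\to\mathbb Z_{\ge1}$.
   Context: Posets carry the topology whose open sets are the up-closed sets (up-sets); connectedness refers to this topology. For a subset $S$ of a poset $\Sigma$, $\uparrow_\Sigma S$ and $\downarrow_\Sigma S$ are the up-set and down-set generated by $S$; for $\alpha\in\Sigma$ write $\uparrow_\Sigma\alpha$, $\downarrow_\Sigma\alpha$. $\alpha\lessdot\gamma$ means $\gamma$ covers $\alpha$. A graded poset is a finite poset $\Sigma$ with an order-preserving rank function $\mathrm{rk}:\Sigma\to\mathbb N$ such that, for $\alpha<\gamma$, $\alpha\lessdot\gamma$ iff $\mathrm{rk}\,\gamma=\mathrm{rk}\,\alpha+1$; all minimal elements have rank $0$. $\Sigma(k)$ is the set of rank-$k$ elements, and $\dim\Sigma$ is the maximal value of $\mathrm{rk}$. A graded poset $\Delta$ of dimension $d$ is strongly connected if $\Delta$ is connected and for every $\alpha\in\downarrow_\Delta\Delta(d-2)$ the up-set $(\uparrow_\Delta\alpha)\setminus\{\alpha\}$ is connected. An order-preserving map $\varphi:\Sigma\to\Delta$ of finite posets is combinatorial if for all $\alpha\in\Sigma$ it maps $\downarrow_\Sigma\alpha$ isomorphically onto $\downarrow_\Delta\varphi(\alpha)$.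 For an up-set $\mathcal V\subset\Sigma$, a map $m_{\mathcal V}:\mathcal V\to\mathbb Z_{\ge1}$ is balanced (with respect to $\varphi$) if for every $\alpha\in\mathcal V$ and every $\beta\in\Delta$ with $\varphi(\alpha)\lessdot\beta$ one has $m_{\mathcal V}(\alpha)=\sum_{\gamma\in\varphi^{-1}(\beta),\ \alpha\lessdot\gamma}m_{\mathcal V}(\gamma)$ (empty sums are $0$).
   Formalization: Adds the hypothesis that each element of Σ outside V that is maximal in Σ has image maximal in Δ; without it the claim fails (Δ a chain a<b<c, Σ a copy plus an isolated point sent to a), and any balanced extension forces it. *)

theory Defs
  imports "HOL-Analysis.Analysis"
begin

text \<open>
  A poset is a carrier set \<open>S\<close> inside a type of class \<^class>\<open>order\<close>, with the induced order.
  Up-sets, down-sets and the covering relation are all relative to the carrier.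
\<close>

definition up_closure :: "'a::order set \<Rightarrow> 'a set \<Rightarrow> 'a set" where
  "up_closure S A = {y \<in> S. \<exists>x\<in>A. x \<le> y}"

definition down_closure :: "'a::order set \<Rightarrow> 'a set \<Rightarrow> 'a set" where
  "down_closure S A = {y \<in> S. \<exists>x\<in>A. y \<le> x}"

definition covered_by :: "'a::order set \<Rightarrow> 'a \<Rightarrow> 'a \<Rightarrow> bool" where
  "covered_by S x y \<longleftrightarrow> x \<in> S \<and> y \<in> S \<and> x < y \<and> \<not> (\<exists>z\<in>S. x < z \<and> z < y)"

definition is_up_set :: "'a::order set \<Rightarrow> 'a set \<Rightarrow> bool" where
  "is_up_set S U \<longleftrightarrow> U \<subseteq> S \<and> (\<forall>x\<in>U. \<forall>y\<in>S. x \<le> y \<longrightarrow> y \<in> U)"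

definition up_topology :: "'a::order set \<Rightarrow> 'a topology" where
  "up_topology S = topology (is_up_set S)"

lemma istopology_is_up_set: "istopology (is_up_set S)"
  unfolding istopology_def is_up_set_def by blast

lemma openin_up_topology [simp]: "openin (up_topology S) = is_up_set S"
  unfolding up_topology_def by (rule topology_inverse'[OF istopology_is_up_set])

lemma topspace_up_topology [simp]: "topspace (up_topology S) = S"
  unfolding topspace_def by (auto simp: is_up_set_def)

definition graded_poset :: "'a::order set \<Rightarrow> ('a \<Rightarrow> nat) \<Rightarrow> bool" where
  "graded_poset S rk \<longleftrightarrow>
     finite S \<and> mono_on S rk \<and>
     (\<forall>x\<in>S. \<forall>y\<in>S. x < y \<longrightarrow> (covered_by S x y \<longleftrightarrow> rk y = rk x + 1)) \<and>
     (\<forall>x\<in>S. \<not> (\<exists>y\<in>S. y < x) \<longrightarrow> rk x = 0)"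

text \<open>
  Ranks are indexed by integers, so that the level is empty for a negative index
  (as happens for \<open>d - 1\<close> and \<open>d - 2\<close> when \<open>d\<close> is small).
\<close>

definition rank_level :: "'a set \<Rightarrow> ('a \<Rightarrow> nat) \<Rightarrow> int \<Rightarrow> 'a set" where
  "rank_level S rk k = {x \<in> S. int (rk x) = k}"

text \<open>The dimension is meaningful only for a nonempty finite poset.\<close>

definition poset_dim :: "'a set \<Rightarrow> ('a \<Rightarrow> nat) \<Rightarrow> nat" where
  "poset_dim S rk = Max (rk ` S)"

definition strongly_connected :: "'a::order set \<Rightarrow> ('a \<Rightarrow> nat) \<Rightarrow> bool" where
  "strongly_connected S rk \<longleftrightarrow>
     connected_space (up_topology S) \<and>
     (\<forall>\<alpha> \<in> down_closure S (rank_level S rk (int (poset_dim S rk) - 2)).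
        connectedin (up_topology S) (up_closure S {\<alpha>} - {\<alpha>}))"

definition combinatorial ::
  "'a::order set \<Rightarrow> 'b::order set \<Rightarrow> ('a \<Rightarrow> 'b) \<Rightarrow> bool" where
  "combinatorial S D \<phi> \<longleftrightarrow>
     \<phi> \<in> S \<rightarrow> D \<and> monotone_on S (\<le>) (\<le>) \<phi> \<and>
     (\<forall>\<alpha>\<in>S.
        bij_betw \<phi> (down_closure S {\<alpha>}) (down_closure D {\<phi> \<alpha>}) \<and>
        (\<forall>x \<in> down_closure S {\<alpha>}. \<forall>y \<in> down_closure S {\<alpha>}. x \<le> y \<longleftrightarrow> \<phi> x \<le> \<phi> y))"

text \<open>
  A map on an up-set \<open>V\<close> of \<open>S\<close> is a function on the whole type of which only the values on
  \<open>V\<close> matter: every element covering an element of \<open>V\<close> lies in \<open>V\<close>.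
\<close>

definition balanced ::
  "'a::order set \<Rightarrow> 'b::order set \<Rightarrow> ('a \<Rightarrow> 'b) \<Rightarrow> 'a set \<Rightarrow> ('a \<Rightarrow> int) \<Rightarrow> bool" where
  "balanced S D \<phi> V m \<longleftrightarrow>
     is_up_set S V \<and> m \<in> V \<rightarrow> {1..} \<and>
     (\<forall>\<alpha>\<in>V. \<forall>\<beta>\<in>D. covered_by D (\<phi> \<alpha>) \<beta> \<longrightarrow>
        m \<alpha> = (\<Sum>\<gamma> | \<gamma> \<in> S \<and> \<phi> \<gamma> = \<beta> \<and> covered_by S \<alpha> \<gamma>. m \<gamma>))"

end

theory Submission
  imports Defs
begin

text \<open>
  Write \<open>e\<close> for the dimension of the target \<open>D\<close>, and call its elements of rank \<open>e\<close> top
  elements. For \<open>\<alpha> \<in> S\<close> and a top element \<open>\<beta> \<ge> \<phi> \<alpha>\<close> of \<open>D\<close>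
  let \<open>M(\<alpha>, \<beta>)\<close> be the sum of \<open>m \<gamma>\<close> over the \<open>\<gamma> \<ge> \<alpha>\<close> lying above \<open>\<beta>\<close>. Iterating the balancing
  condition shows that any balanced extension of \<open>m\<close> must take the value \<open>M(\<alpha>, \<beta>)\<close> at \<open>\<alpha>\<close>; so the
  extension is defined by this formula, and the whole point is that \<open>M(\<alpha>, \<beta>)\<close> does not depend
  on \<open>\<beta>\<close> (\<open>fibre_mass_independent\<close>).

  Since \<open>\<phi>\<close> restricts to isomorphisms of principal down-sets, every \<open>\<gamma> \<ge> \<alpha>\<close> above \<open>\<beta>\<close> dominates
  exactly one element above a given intermediate \<open>\<delta>\<close>. Hence \<open>M(\<alpha>, \<beta>)\<close> is the sum of \<open>M(x, \<beta>)\<close>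
  over the \<open>x \<ge> \<alpha>\<close> above \<open>\<delta>\<close> (\<open>fibre_mass_decompose\<close>). For \<open>\<delta>\<close> covering \<open>\<phi> \<alpha>\<close> this is
  the balancing condition. It also drives a downward induction on the rank of \<open>\<alpha>\<close>: two top elements
  that both dominate some \<open>\<delta> > \<phi> \<alpha>\<close> give the same value \<open>M(\<alpha>, _)\<close>, because the terms \<open>M(x, _)\<close>
  agree. So \<open>M(\<alpha>, _)\<close> induces a locally constant function of \<open>\<delta>\<close> on the elements strictly above
  \<open>\<phi> \<alpha>\<close>, and these form a connected set when \<open>\<alpha>\<close> has rank at most \<open>e - 2\<close>. In rank \<open>e - 1\<close>
  independence is the assumed balancing of \<open>m\<close>, and in rank \<open>e\<close> the only choice is \<open>\<beta> = \<phi> \<alpha>\<close>.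

  Strong connectedness moreover makes \<open>D\<close> pure (\<open>strongly_connected_pure\<close>). This ensures
  that every element of rank at most \<open>e - 2\<close> has a connected strict up-set, that \<open>S\<close> and \<open>D\<close> have the
  same dimension, and, with the hypothesis on maximal elements, that every \<open>\<alpha>\<close> lies below an
  element of rank \<open>e\<close> in \<open>S\<close>, so that the extension is positive.
\<close>

section \<open>Connectedness in the up-set topology\<close>

lemma up_connected_cong:
  fixes D :: "'b::order set"
  assumes con: "connectedin (up_topology D) U" and up: "is_up_set D U"
    and P: "\<And>x y. x \<in> U \<Longrightarrow> y \<in> U \<Longrightarrow> x \<le> y \<Longrightarrow> P x \<longleftrightarrow> P y"
    and "x \<in> U" "y \<in> U" "P x"
  shows "P y"
proof (rule ccontr)
  assume "\<not> P y"
  let ?A = "{z \<in> U. P z}" and ?B = "{z \<in> U. \<not> P z}"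
  have "is_up_set D ?A" "is_up_set D ?B"
    using up P unfolding is_up_set_def by blast+
  moreover have "U \<subseteq> ?A \<union> ?B" "?A \<inter> ?B \<inter> U = {}" by auto
  moreover have "?A \<inter> U \<noteq> {}" "?B \<inter> U \<noteq> {}" using \<open>\<not> P y\<close> assms(4-6) by auto
  ultimately show False using con unfolding connectedin openin_up_topology by blast
qed

section \<open>Ranks\<close>

lemma graded_rk_le:
  "graded_poset S rk \<Longrightarrow> x \<in> S \<Longrightarrow> y \<in> S \<Longrightarrow> x \<le> y \<Longrightarrow> rk x \<le> rk y"
  unfolding graded_poset_def by (auto dest: mono_onD)

lemma graded_cover_rk:
  "graded_poset S rk \<Longrightarrow> covered_by S x y \<Longrightarrow> rk y = rk x + 1"
  unfolding graded_poset_def covered_by_def by blast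

lemma rk_Suc_covered:
  "graded_poset S rk \<Longrightarrow> x \<in> S \<Longrightarrow> y \<in> S \<Longrightarrow> x < y \<Longrightarrow> rk y = rk x + 1 \<Longrightarrow> covered_by S x y"
  unfolding graded_poset_def by blast

lemma ex_cover_above:
  fixes S :: "'a::order set"
  assumes "finite S" "x \<in> S" "y \<in> S" "x < y"
  shows "\<exists>z. covered_by S x z \<and> z \<le> y"
proof -
  have fin: "finite {z\<in>S. x < z \<and> z \<le> y}"
    and ne: "{z\<in>S. x < z \<and> z \<le> y} \<noteq> {}" using assms by auto
  obtain z where z: "z \<in> {z\<in>S. x < z \<and> z \<le> y}"
    and min: "\<And>w. w \<in> {z\<in>S. x < z \<and> z \<le> y} \<Longrightarrow> w \<le> z \<Longrightarrow> z = w"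
    using finite_has_minimal[OF fin ne] by blast
  have "\<not> (w \<in> S \<and> x < w \<and> w < z)" for w
  proof
    assume w: "w \<in> S \<and> x < w \<and> w < z"
    have "w \<le> y" by (rule order.trans[of w z y]) (use w z in auto)
    then show False using min[of w] w by (auto simp: order.strict_implies_order)
  qed
  then show ?thesis using z assms unfolding covered_by_def by auto
qed

lemma ex_cover_below:
  fixes S :: "'a::order set"
  assumes "finite S" "x \<in> S" "y \<in> S" "x < y"
  shows "\<exists>z. covered_by S z y \<and> x \<le> z"
proof -
  have fin: "finite {z\<in>S. x \<le> z \<and> z < y}"
    and ne: "{z\<in>S. x \<le> z \<and> z < y} \<noteq> {}" using assms by auto
  obtain z where z: "z \<in> {z\<in>S. x \<le> z \<and> z < y}"
    and max: "\<And>w. w \<in> {z\<in>S. x \<le> z \<and> z < y} \<Longrightarrow> z \<le> w \<Longrightarrow> z = w"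
    using finite_has_maximal[OF fin ne] by blast
  have "\<not> (w \<in> S \<and> z < w \<and> w < y)" for w
  proof
    assume w: "w \<in> S \<and> z < w \<and> w < y"
    have "x \<le> w" by (rule order.trans[of x z w]) (use w z in auto)
    then show False using max[of w] w by (auto simp: order.strict_implies_order)
  qed
  then show ?thesis using z assms unfolding covered_by_def by auto
qed

lemma graded_rk_less:
  assumes g: "graded_poset S rk" and "x \<in> S" "y \<in> S" "x < y"
  shows "rk x < rk y"
proof -
  have "finite S" using g by (simp add: graded_poset_def)
  then obtain z where z: "covered_by S x z" "z \<le> y" using ex_cover_above assms by blast
  have "rk z = rk x + 1" using graded_cover_rk g z by blast
  moreover have "rk z \<le> rk y" using graded_rk_le[OF g] z assms by (auto simp: covered_by_def)
  ultimately show ?thesis by simp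
qed

lemma graded_ex_rk_between:
  assumes g: "graded_poset S rk" and "a \<in> S" "x \<in> S" "a \<le> x" "rk a \<le> k" "k \<le> rk x"
  shows "\<exists>y\<in>S. a \<le> y \<and> y \<le> x \<and> rk y = k"
  using assms(3-)
proof (induction "rk x - k" arbitrary: x)
  case 0
  then show ?case by auto
next
  case (Suc n)
  have "a < x" using Suc by (auto simp: order.order_iff_strict)
  moreover have "finite S" using g by (simp add: graded_poset_def)
  ultimately obtain z where z: "covered_by S z x" "a \<le> z"
    using ex_cover_below \<open>a \<in> S\<close> Suc.prems by blast
  have "z \<in> S" "z < x" using z by (auto simp: covered_by_def)
  have "rk x = rk z + 1" using graded_cover_rk g z by blast
  then have "n = rk z - k" "k \<le> rk z" using Suc.hyps(2) by linarith+
  then obtain y where "y \<in> S" "a \<le> y" "y \<le> z" "rk y = k"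
    using Suc.hyps(1)[of z] Suc.prems z \<open>z \<in> S\<close> by blast
  moreover from this have "y \<le> x" using \<open>z < x\<close> by (auto intro: order.trans[of y z x])
  ultimately show ?case by blast
qed

lemma graded_ex_cover_of_rk_pos:
  assumes g: "graded_poset S rk" and "x \<in> S" "rk x \<noteq> 0"
  shows "\<exists>y. covered_by S y x"
proof -
  have "\<not> (\<exists>y\<in>S. y < x) \<Longrightarrow> rk x = 0" using g \<open>x \<in> S\<close> by (simp add: graded_poset_def)
  then obtain a where "a \<in> S" "a < x" using \<open>rk x \<noteq> 0\<close> by blast
  then show ?thesis using ex_cover_below[OF _ \<open>a \<in> S\<close> \<open>x \<in> S\<close>] g by (auto simp: graded_poset_def)
qed

lemma rk_le_poset_dim: "graded_poset S rk \<Longrightarrow> x \<in> S \<Longrightarrow> rk x \<le> poset_dim S rk"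
  unfolding graded_poset_def poset_dim_def by simp

lemma ex_rk_poset_dim:
  assumes "graded_poset S rk" "S \<noteq> {}"
  shows "\<exists>x\<in>S. rk x = poset_dim S rk"
proof -
  have "Max (rk ` S) \<in> rk ` S" using assms by (intro Max_in) (auto simp: graded_poset_def)
  then show ?thesis unfolding poset_dim_def by auto
qed

lemma in_up_closure_corank_1:
  assumes g: "graded_poset S rk" and "x \<in> S" "d \<le> rk x + 1" "rk x \<le> d" "d \<noteq> 0"
  shows "x \<in> up_closure S (rank_level S rk (int d - 1))"
proof (cases "rk x = d")
  case True
  then obtain y where y: "covered_by S y x" using graded_ex_cover_of_rk_pos assms by metis
  then have "rk x = rk y + 1" using graded_cover_rk g by blast
  then show ?thesis using y True \<open>x \<in> S\<close>
    by (auto simp: up_closure_def rank_level_def covered_by_def intro!: bexI[of _ y])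
next
  case False
  then show ?thesis using assms by (auto simp: up_closure_def rank_level_def intro!: bexI[of _ x])
qed

section \<open>Purity of strongly connected posets\<close>

lemma strict_up_set: "is_up_set D (up_closure D {a} - {a})"
  unfolding is_up_set_def up_closure_def by auto

lemma strongly_connected_link:
  assumes g: "graded_poset D rk" and sc: "strongly_connected D rk"
    and "a \<in> D" "y \<in> D" "a \<le> y" "rk y = poset_dim D rk" "rk a + 2 \<le> poset_dim D rk"
  shows "connectedin (up_topology D) (up_closure D {a} - {a})"
proof -
  have "rk a \<le> poset_dim D rk - 2" "poset_dim D rk - 2 \<le> rk y" using assms by linarith+
  then obtain z where "z \<in> D" "a \<le> z" "rk z = poset_dim D rk - 2"
    using graded_ex_rk_between[OF g \<open>a \<in> D\<close> \<open>y \<in> D\<close> \<open>a \<le> y\<close>] by blast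
  then have "a \<in> down_closure D (rank_level D rk (int (poset_dim D rk) - 2))"
    using assms by (auto simp: down_closure_def rank_level_def intro!: bexI[of _ z])
  then show ?thesis using sc by (simp add: strongly_connected_def)
qed

text \<open>
  The elements dominated by some element of maximal rank form a down-set. It is also an up-set:
  an element \<open>a\<close> of largest possible rank violating this would split its strict up-set, which is
  connected. Connectedness of the whole poset then leaves no room for anything else.
\<close>

lemma strongly_connected_pure:
  assumes g: "graded_poset D rk" and sc: "strongly_connected D rk" and "x \<in> D"
  shows "\<exists>y\<in>D. rk y = poset_dim D rk \<and> x \<le> y"
proof -
  define e where "e = poset_dim D rk"
  define P where "P x \<longleftrightarrow> (\<exists>y\<in>D. rk y = e \<and> x \<le> y)" for x
  have down: "P a" if "a \<le> c" "P c" for a c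
    using that unfolding P_def by (meson order.trans)
  have up: "P c" if "a \<in> D" "P a" "c \<in> D" "a \<le> c" for a c
    using that
  proof (induction "e - rk a" arbitrary: a c rule: less_induct)
    case less
    show ?case
    proof (cases "a = c")
      case True
      then show ?thesis using less by simp
    next
      case False
      then have ac: "a < c" using less by simp
      have rkc: "rk a < rk c" "rk c \<le> e"
        using graded_rk_less[OF g] rk_le_poset_dim[OF g] ac less e_def by auto
      show ?thesis
      proof (cases "rk a + 2 \<le> e")
        case True
        obtain y where y: "y \<in> D" "rk y = e" "a \<le> y" using less.prems(2) unfolding P_def by blast
        let ?U = "up_closure D {a} - {a}"
        have con: "connectedin (up_topology D) ?U"
          using strongly_connected_link[OF g sc less.prems(1) y(1) y(3)] y True e_def by simp
        have "P u \<longleftrightarrow> P v" if uv: "u \<in> ?U" "v \<in> ?U" "u \<le> v" for u v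
        proof
          have "u \<in> D" "v \<in> D" "a < u" using uv by (auto simp: up_closure_def)
          moreover have "e - rk u < e - rk a"
            using graded_rk_less[OF g \<open>a \<in> D\<close> \<open>u \<in> D\<close> \<open>a < u\<close>] True by linarith
          moreover assume "P u"
          ultimately show "P v" using less.hyps uv by blast
        qed (use down uv in blast)
        moreover have "y \<in> ?U" "P y" "c \<in> ?U"
          using y True ac less.prems by (auto simp: up_closure_def P_def)
        ultimately show ?thesis using up_connected_cong[OF con strict_up_set] by blast
      next
        case False
        then have "rk c = e" using rkc by simp
        then show ?thesis using less.prems P_def by auto
      qed
    qed
  qed
  obtain t where "t \<in> D" "rk t = e" using ex_rk_poset_dim g \<open>x \<in> D\<close> e_def by fastforce
  then have t: "t \<in> D" "P t" by (auto simp: P_def)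
  have "connectedin (up_topology D) D"
    using sc connectedin_topspace[of "up_topology D"] by (simp add: strongly_connected_def)
  moreover have "is_up_set D D" by (simp add: is_up_set_def)
  ultimately have "P x" using up_connected_cong[of D D P t x] up down t \<open>x \<in> D\<close> by blast
  then show ?thesis by (simp add: P_def e_def)
qed

section \<open>Combinatorial morphisms\<close>

lemma combinatorial_in: "combinatorial S D \<phi> \<Longrightarrow> x \<in> S \<Longrightarrow> \<phi> x \<in> D"
  unfolding combinatorial_def by auto

lemma combinatorial_mono:
  "combinatorial S D \<phi> \<Longrightarrow> x \<in> S \<Longrightarrow> y \<in> S \<Longrightarrow> x \<le> y \<Longrightarrow> \<phi> x \<le> \<phi> y"
  unfolding combinatorial_def monotone_on_def by auto

lemma combinatorial_le_iff:
  assumes "combinatorial S D \<phi>" "c \<in> S" "x \<in> S" "y \<in> S" "x \<le> c" "y \<le> c"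
  shows "x \<le> y \<longleftrightarrow> \<phi> x \<le> \<phi> y"
proof -
  have "\<forall>x\<in>down_closure S {c}. \<forall>y\<in>down_closure S {c}. x \<le> y \<longleftrightarrow> \<phi> x \<le> \<phi> y"
    using assms(1,2) by (simp add: combinatorial_def)
  moreover have "x \<in> down_closure S {c}" "y \<in> down_closure S {c}"
    using assms by (auto simp: down_closure_def)
  ultimately show ?thesis by blast
qed

lemma combinatorial_inj:
  "combinatorial S D \<phi> \<Longrightarrow> c \<in> S \<Longrightarrow> x \<in> S \<Longrightarrow> y \<in> S \<Longrightarrow> x \<le> c \<Longrightarrow> y \<le> c \<Longrightarrow>
    \<phi> x = \<phi> y \<Longrightarrow> x = y"
  using combinatorial_le_iff[of S D \<phi> c x y] combinatorial_le_iff[of S D \<phi> c y x] by auto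

lemma combinatorial_strict_mono:
  assumes "combinatorial S D \<phi>" "x \<in> S" "y \<in> S" "x < y"
  shows "\<phi> x < \<phi> y"
proof -
  have "\<phi> x \<noteq> \<phi> y"
    using combinatorial_inj[OF assms(1,3,2,3)] order.strict_implies_order[OF \<open>x < y\<close>] assms(4)
    by blast
  then show ?thesis
    using combinatorial_mono[OF assms(1-3)] \<open>x < y\<close> by (simp add: order.strict_iff_order)
qed

lemma combinatorial_lift:
  assumes "combinatorial S D \<phi>" "c \<in> S" "b \<in> D" "b \<le> \<phi> c"
  shows "\<exists>x\<in>S. x \<le> c \<and> \<phi> x = b"
proof -
  have "bij_betw \<phi> (down_closure S {c}) (down_closure D {\<phi> c})"
    using assms by (simp add: combinatorial_def)
  moreover have "b \<in> down_closure D {\<phi> c}" using assms by (auto simp: down_closure_def)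
  ultimately have "b \<in> \<phi> ` down_closure S {c}" by (simp add: bij_betw_imp_surj_on)
  then show ?thesis by (auto simp: down_closure_def)
qed

lemma combinatorial_cover:
  assumes c: "combinatorial S D \<phi>" and "covered_by S x y"
  shows "covered_by D (\<phi> x) (\<phi> y)"
proof -
  have xy: "x \<in> S" "y \<in> S" "x < y" using assms by (auto simp: covered_by_def)
  have "\<not> (\<phi> x < w \<and> w < \<phi> y)" if "w \<in> D" for w
  proof
    assume w: "\<phi> x < w \<and> w < \<phi> y"
    then obtain z where z: "z \<in> S" "z \<le> y" "\<phi> z = w"
      using combinatorial_lift[OF c _ \<open>w \<in> D\<close>] xy by fastforce
    moreover have "x \<le> z" using combinatorial_le_iff[OF c, of y x z] xy z w by auto
    ultimately have "x < z" "z < y" using w by (auto simp: order.order_iff_strict)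
    then show False using assms z by (auto simp: covered_by_def)
  qed
  then show ?thesis
    using xy combinatorial_in[OF c] combinatorial_strict_mono[OF c] by (auto simp: covered_by_def)
qed

text \<open>
  The rank of an element is the length of a saturated chain below it, and principal
  down-sets are mapped isomorphically.
\<close>

lemma combinatorial_rk:
  assumes gS: "graded_poset S rkS" and gD: "graded_poset D rkD" and c: "combinatorial S D \<phi>"
    and "x \<in> S"
  shows "rkD (\<phi> x) = rkS x"
  using \<open>x \<in> S\<close>
proof (induction "rkS x" arbitrary: x)
  case 0
  have "\<not> b < \<phi> x" if "b \<in> D" for b
  proof
    assume b: "b < \<phi> x"
    then obtain y where "y \<in> S" "y \<le> x" "\<phi> y = b"
      using combinatorial_lift[OF c _ \<open>b \<in> D\<close>] 0 by fastforce
    moreover from this have "y < x" using b by (auto simp: order.order_iff_strict)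
    ultimately show False using graded_rk_less[OF gS] 0 by fastforce
  qed
  then show ?case using gD combinatorial_in[OF c] 0 unfolding graded_poset_def by auto
next
  case (Suc n)
  then obtain y where y: "covered_by S y x" using graded_ex_cover_of_rk_pos[OF gS, of x] by auto
  then have "rkS x = rkS y + 1" "y \<in> S"
    using graded_cover_rk[OF gS] by (auto simp: covered_by_def)
  moreover have "rkD (\<phi> x) = rkD (\<phi> y) + 1"
    using graded_cover_rk[OF gD] combinatorial_cover[OF c y] by blast
  ultimately show ?case using Suc by simp
qed

text \<open>
  In this form the sums occurring in the balancing condition become instances of the
  sums over all elements of a fibre above a given element.
\<close>

lemma covers_in_fibre:
  assumes c: "combinatorial S D \<phi>" and "a \<in> S" "covered_by D (\<phi> a) b"
  shows "{x. x \<in> S \<and> \<phi> x = b \<and> covered_by S a x} = {x \<in> S. a \<le> x \<and> \<phi> x = b}"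
proof (intro equalityI subsetI)
  fix x assume x: "x \<in> {x \<in> S. a \<le> x \<and> \<phi> x = b}"
  have "\<not> (a < z \<and> z < x)" if "z \<in> S" for z
    using combinatorial_strict_mono[OF c, of a z] combinatorial_strict_mono[OF c, of z x]
      combinatorial_in[OF c that] that x assms by (auto simp: covered_by_def)
  moreover have "a \<noteq> x" using x assms by (auto simp: covered_by_def)
  ultimately show "x \<in> {x. x \<in> S \<and> \<phi> x = b \<and> covered_by S a x}"
    using x \<open>a \<in> S\<close> by (auto simp: covered_by_def)
qed (auto simp: covered_by_def)

section \<open>Total mass over a top element\<close>

definition fibre_mass :: "'a::order set \<Rightarrow> ('a \<Rightarrow> 'b) \<Rightarrow> ('a \<Rightarrow> int) \<Rightarrow> 'a \<Rightarrow> 'b \<Rightarrow> int" where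
  "fibre_mass S \<phi> m a b = (\<Sum>x\<in>{x \<in> S. a \<le> x \<and> \<phi> x = b}. m x)"

text \<open>
  Each \<open>c \<ge> a\<close> above \<open>b\<close> dominates exactly one element \<open>x\<close> above \<open>\<delta>\<close>, and this \<open>x\<close> satisfies
  \<open>a \<le> x\<close> because \<open>\<phi>\<close> reflects the order below \<open>c\<close>.
\<close>

lemma fibre_mass_decompose:
  assumes c: "combinatorial S D \<phi>" and fin: "finite S"
    and "a \<in> S" "\<delta> \<in> D" "\<phi> a \<le> \<delta>" "\<delta> \<le> b"
  shows "fibre_mass S \<phi> m a b = (\<Sum>x\<in>{x \<in> S. a \<le> x \<and> \<phi> x = \<delta>}. fibre_mass S \<phi> m x b)"
proof -
  let ?I = "{x \<in> S. a \<le> x \<and> \<phi> x = \<delta>}" and ?F = "\<lambda>x. {y \<in> S. x \<le> y \<and> \<phi> y = b}"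
  have "?F a = (\<Union>x\<in>?I. ?F x)"
  proof (intro equalityI subsetI)
    fix y assume y: "y \<in> ?F a"
    then obtain x where x: "x \<in> S" "x \<le> y" "\<phi> x = \<delta>"
      using combinatorial_lift[OF c, of y \<delta>] assms by auto
    moreover have "a \<le> x" using combinatorial_le_iff[OF c, of y a x] x y assms by auto
    ultimately show "y \<in> (\<Union>x\<in>?I. ?F x)" using y by auto
  qed (auto intro: order.trans)
  moreover have "(\<Sum>y\<in>(\<Union>x\<in>?I. ?F x). m y) = (\<Sum>x\<in>?I. \<Sum>y\<in>?F x. m y)"
  proof (rule sum.UNION_disjoint)
    show "\<forall>x\<in>?I. \<forall>x'\<in>?I. x \<noteq> x' \<longrightarrow> ?F x \<inter> ?F x' = {}"
      using combinatorial_inj[OF c] by auto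
  qed (use fin in auto)
  ultimately show ?thesis by (simp add: fibre_mass_def)
qed

lemma fibre_mass_self:
  assumes c: "combinatorial S D \<phi>" and "a \<in> S"
  shows "fibre_mass S \<phi> m a (\<phi> a) = m a"
proof -
  have "{x \<in> S. a \<le> x \<and> \<phi> x = \<phi> a} = {a}"
    using combinatorial_inj[OF c _ \<open>a \<in> S\<close>] \<open>a \<in> S\<close> by fastforce
  then show ?thesis by (simp add: fibre_mass_def)
qed

lemma fibre_mass_balanced:
  assumes c: "combinatorial S D \<phi>" and bal: "balanced S D \<phi> V m"
    and "a \<in> V" "b = \<phi> a \<or> covered_by D (\<phi> a) b"
  shows "fibre_mass S \<phi> m a b = m a"
proof (cases "b = \<phi> a")
  case True
  moreover have "a \<in> S" using bal \<open>a \<in> V\<close> by (auto simp: balanced_def is_up_set_def)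
  ultimately show ?thesis using fibre_mass_self[OF c] by simp
next
  case False
  then have cov: "covered_by D (\<phi> a) b" using assms by simp
  then have "b \<in> D" by (simp add: covered_by_def)
  have "a \<in> S" using bal \<open>a \<in> V\<close> by (auto simp: balanced_def is_up_set_def)
  then show ?thesis
    using bal \<open>a \<in> V\<close> \<open>b \<in> D\<close> cov covers_in_fibre[OF c _ cov]
    unfolding balanced_def fibre_mass_def by simp
qed

lemma fibre_mass_top_balanced:
  assumes gS: "graded_poset S rkS" and gD: "graded_poset D rkD" and c: "combinatorial S D \<phi>"
    and bal: "balanced S D \<phi> V m"
    and "a \<in> V" "b \<in> D" "\<phi> a \<le> b" "rkD b \<le> rkS a + 1"
  shows "fibre_mass S \<phi> m a b = m a"
proof (rule fibre_mass_balanced[OF c bal \<open>a \<in> V\<close>])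
  have "a \<in> S" using bal \<open>a \<in> V\<close> by (auto simp: balanced_def is_up_set_def)
  moreover from this have "\<phi> a \<in> D" "rkD (\<phi> a) = rkS a"
    using combinatorial_in[OF c] combinatorial_rk[OF gS gD c] by auto
  ultimately show "b = \<phi> a \<or> covered_by D (\<phi> a) b"
    using assms graded_rk_less[OF gD, of "\<phi> a" b] rk_Suc_covered[OF gD, of "\<phi> a" b]
    by (auto simp: order.order_iff_strict)
qed

text \<open>
  For \<open>\<delta>\<close> strictly above \<open>\<phi> a\<close>, the common value of \<open>fibre_mass S \<phi> m a\<close> on the top elements
  dominating \<open>\<delta>\<close> is well defined by induction. Comparable elements \<open>\<delta> \<le> \<delta>'\<close> share a top element, so
  this value is the same for both, and connectedness makes it constant.
\<close>

lemma fibre_mass_independent: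
  assumes gS: "graded_poset S rkS" and gD: "graded_poset D rkD" and c: "combinatorial S D \<phi>"
    and sc: "strongly_connected D rkD" and bal: "balanced S D \<phi> V m"
    and e: "e = poset_dim D rkD"
    and V: "\<And>x. x \<in> S \<Longrightarrow> e \<le> rkS x + 1 \<Longrightarrow> x \<in> V"
    and "a \<in> S" "b \<in> D" "b' \<in> D" "rkD b = e" "rkD b' = e" "\<phi> a \<le> b" "\<phi> a \<le> b'"
  shows "fibre_mass S \<phi> m a b = fibre_mass S \<phi> m a b'"
  using assms(8-)
proof (induction "e - rkS a" arbitrary: a b b' rule: less_induct)
  case less
  note fin = gS[unfolded graded_poset_def, THEN conjunct1]
  let ?M = "fibre_mass S \<phi> m"
  have rka: "rkD (\<phi> a) = rkS a" and phia: "\<phi> a \<in> D"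
    using combinatorial_rk[OF gS gD c] combinatorial_in[OF c] less.prems by auto
  show ?case
  proof (cases "rkS a + 2 \<le> e")
    case False
    then have "a \<in> V" using V less.prems by simp
    then show ?thesis
      using fibre_mass_top_balanced[OF gS gD c bal, of a] less.prems False by simp
  next
    case True
    let ?U = "up_closure D {\<phi> a} - {\<phi> a}"
    have con: "connectedin (up_topology D) ?U"
      using strongly_connected_link[OF gD sc phia \<open>b \<in> D\<close>] less.prems True rka e by simp
    have common: "?M a t = ?M a t'"
      if "\<delta> \<in> ?U" and t: "t \<in> D" "t' \<in> D" "rkD t = e" "rkD t' = e" "\<delta> \<le> t" "\<delta> \<le> t'"
      for \<delta> t t'
    proof -
      have \<delta>: "\<delta> \<in> D" "\<phi> a < \<delta>" using that by (auto simp: up_closure_def)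
      have "?M x t = ?M x t'" if "x \<in> {x \<in> S. a \<le> x \<and> \<phi> x = \<delta>}" for x
      proof (rule less.hyps)
        have "a < x" using that \<delta> by (auto simp: order.order_iff_strict)
        then show "e - rkS x < e - rkS a"
          using graded_rk_less[OF gS, of a x] that less.prems True by auto
      qed (use that t in auto)
      then show ?thesis
        using fibre_mass_decompose[OF c fin \<open>a \<in> S\<close> \<open>\<delta> \<in> D\<close>] \<delta> t by (auto intro!: sum.cong)
    qed
    define P where "P \<delta> \<longleftrightarrow> (\<exists>t\<in>D. rkD t = e \<and> \<delta> \<le> t \<and> ?M a t = ?M a b)" for \<delta>
    have "P \<delta> \<longleftrightarrow> P \<delta>'" if \<delta>: "\<delta> \<in> ?U" "\<delta>' \<in> ?U" "\<delta> \<le> \<delta>'" for \<delta> \<delta>'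
    proof
      assume "P \<delta>"
      then obtain t where t: "t \<in> D" "rkD t = e" "\<delta> \<le> t" "?M a t = ?M a b"
        unfolding P_def by blast
      obtain t' where t': "t' \<in> D" "rkD t' = e" "\<delta>' \<le> t'"
        using strongly_connected_pure[OF gD sc, of \<delta>'] \<delta> e by (auto simp: up_closure_def)
      have "?M a t = ?M a t'" using common[of \<delta> t t'] \<delta> t t' by auto
      then show "P \<delta>'" using t t' unfolding P_def by auto
    next
      assume "P \<delta>'"
      then show "P \<delta>" using \<delta> unfolding P_def by (meson order.trans)
    qed
    moreover have "b \<in> ?U" "b' \<in> ?U" using less.prems True rka by (auto simp: up_closure_def)
    moreover have "P b" using less.prems unfolding P_def by auto
    ultimately have "P b'" using up_connected_cong[OF con strict_up_set] by blast
    then obtain t where "t \<in> D" "rkD t = e" "b' \<le> t" "?M a t = ?M a b"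
      unfolding P_def by blast
    then show ?thesis using common[OF \<open>b' \<in> ?U\<close>, of t b'] less.prems by simp
  qed
qed

section \<open>Extension of balanced maps\<close>

text \<open>If the image of a maximal element had a cover, balancing there would give an empty sum.\<close>

lemma balanced_maximal:
  fixes D :: "'b::order set"
  assumes bal: "balanced S D \<phi> V m" and c: "combinatorial S D \<phi>" and fin: "finite D"
    and "a \<in> V" and max: "\<forall>x\<in>S. \<not> a < x"
  shows "\<forall>b\<in>D. \<not> \<phi> a < b"
proof (intro ballI notI)
  fix b assume "b \<in> D" "\<phi> a < b"
  have "a \<in> S" using bal \<open>a \<in> V\<close> by (auto simp: balanced_def is_up_set_def)
  then obtain z where z: "covered_by D (\<phi> a) z"
    using ex_cover_above[OF fin _ \<open>b \<in> D\<close> \<open>\<phi> a < b\<close>] combinatorial_in[OF c] by blast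
  moreover have "(\<Sum>x | x \<in> S \<and> \<phi> x = z \<and> covered_by S a x. m x) = 0"
    using max by (intro sum.neutral) (auto simp: covered_by_def)
  moreover have "z \<in> D" using z by (simp add: covered_by_def)
  ultimately have "m a = 0" using bal \<open>a \<in> V\<close> by (simp add: balanced_def)
  moreover have "1 \<le> m a" using bal \<open>a \<in> V\<close> by (auto simp: balanced_def)
  ultimately show False by simp
qed

(* The assumption "maximal" is needed: for an alpha outside V that is maximal in S while its image
   is not maximal in D, the balancing condition at alpha would read m' alpha = 0.  An example is
   D = a chain of three elements, S = a copy of D plus an isolated point that is sent to the
   minimum of D; then V consists of the top two elements of the copy.  Conversely, every balanced
   map on S with positive values forces the assumption. *)

theorem mainTheorem5:
  fixes S :: "'a::order set" and D :: "'b::order set"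
    and rkS :: "'a \<Rightarrow> nat" and rkD :: "'b \<Rightarrow> nat"
    and \<phi> :: "'a \<Rightarrow> 'b" and d :: nat and V :: "'a set" and m :: "'a \<Rightarrow> int"
  assumes "graded_poset S rkS" and "graded_poset D rkD"
    and "combinatorial S D \<phi>"
    and "d = poset_dim S rkS"
    and "V = up_closure S (rank_level S rkS (int d - 1))"
    and "balanced S D \<phi> V m"
    and "strongly_connected D rkD"
    and maximal: "\<And>\<alpha>. \<alpha> \<in> S - V \<Longrightarrow> \<forall>\<gamma>\<in>S. \<not> \<alpha> < \<gamma> \<Longrightarrow> \<forall>\<beta>\<in>D. \<not> \<phi> \<alpha> < \<beta>"
  shows "\<exists>m'. balanced S D \<phi> S m' \<and> (\<forall>\<alpha>\<in>V. m' \<alpha> = m \<alpha>)"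
proof -
  note gS = assms(1) and gD = assms(2) and c = assms(3) and bal = assms(6) and sc = assms(7)
  have finS: "finite S" and finD: "finite D" using gS gD by (auto simp: graded_poset_def)
  have VS: "V \<subseteq> S" using bal by (auto simp: balanced_def is_up_set_def)
  \<comment> \<open>Maximal elements outside \<open>V\<close> are handled by the hypothesis, those in \<open>V\<close> by balancing.\<close>
  have max_image: "\<forall>b\<in>D. \<not> \<phi> a < b" if "a \<in> S" "\<forall>x\<in>S. \<not> a < x" for a
    using that maximal[of a] balanced_maximal[OF bal c finD, of a] by blast
  consider "S = {}" | "S \<noteq> {}" "d = 0" | "S \<noteq> {}" "d \<noteq> 0" by blast
  then show ?thesis
  proof cases
    case 1
    then show ?thesis using bal VS by auto
  next
    \<comment> \<open>Here \<open>V\<close> is empty and \<open>S\<close> is an antichain lying over maximal elements of \<open>D\<close>.\<close>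
    case 2
    have "V = {}" using assms(5) 2 by (auto simp: up_closure_def rank_level_def)
    have "\<not> a < x" if "a \<in> S" "x \<in> S" for a x
      using graded_rk_less[OF gS that] rk_le_poset_dim[OF gS \<open>x \<in> S\<close>] 2 assms(4) by auto
    then have "\<not> covered_by D (\<phi> a) b" if "a \<in> S" for a b
      using max_image[OF that] that by (auto simp: covered_by_def)
    then have "balanced S D \<phi> S (\<lambda>_. 1)" by (auto simp: balanced_def is_up_set_def)
    then show ?thesis using \<open>V = {}\<close> by blast
  next
    case 3
    note pure = strongly_connected_pure[OF gD sc]
    have max_rk: "rkS a = poset_dim D rkD" if "a \<in> S" "\<forall>x\<in>S. \<not> a < x" for a
    proof -
      obtain y where "y \<in> D" "rkD y = poset_dim D rkD" "\<phi> a \<le> y"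
        using pure[OF combinatorial_in[OF c \<open>a \<in> S\<close>]] by blast
      moreover from this have "\<phi> a = y"
        using max_image[OF that] by (auto simp: order.order_iff_strict)
      ultimately show ?thesis using combinatorial_rk[OF gS gD c \<open>a \<in> S\<close>] by simp
    qed
    obtain s where "s \<in> S" "rkS s = d" using ex_rk_poset_dim[OF gS] 3 assms(4) by auto
    moreover have "\<forall>x\<in>S. \<not> s < x"
      using graded_rk_less[OF gS \<open>s \<in> S\<close>] rk_le_poset_dim[OF gS] \<open>rkS s = d\<close> assms(4) by fastforce
    ultimately have de: "d = poset_dim D rkD" using max_rk by auto
    have inV: "x \<in> V" if "x \<in> S" "d \<le> rkS x + 1" for x
      using in_up_closure_corank_1[OF gS that] rk_le_poset_dim[OF gS \<open>x \<in> S\<close>] 3 assms(4,5) by simp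
    have rkV: "d \<le> rkS x + 1" if xV: "x \<in> V" for x
    proof -
      obtain y where "y \<in> S" "y \<le> x" "int (rkS y) = int d - 1"
        using xV assms(5) by (auto simp: up_closure_def rank_level_def)
      moreover have "x \<in> S" using xV VS by blast
      ultimately show ?thesis using graded_rk_le[OF gS, of y x] by linarith
    qed
    let ?M = "fibre_mass S \<phi> m"
    define top_over where "top_over b = (SOME t. t \<in> D \<and> rkD t = d \<and> b \<le> t)" for b
    have top: "top_over b \<in> D \<and> rkD (top_over b) = d \<and> b \<le> top_over b" if "b \<in> D" for b
      unfolding top_over_def by (rule someI_ex) (use pure[OF that] de in blast)
    define m' where "m' a = ?M a (top_over (\<phi> a))" for a
    have m': "m' a = ?M a t" if "a \<in> S" "t \<in> D" "rkD t = d" "\<phi> a \<le> t" for a t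
      unfolding m'_def
      using fibre_mass_independent[OF gS gD c sc bal de inV \<open>a \<in> S\<close> _ \<open>t \<in> D\<close>]
        top[OF combinatorial_in[OF c \<open>a \<in> S\<close>]] that by blast
    have ext: "m' a = m a" if "a \<in> V" for a
      unfolding m'_def
      using fibre_mass_top_balanced[OF gS gD c bal that] rkV[OF that]
        top[OF combinatorial_in[OF c]] that VS by auto
    have pos: "1 \<le> m' a" if "a \<in> S" for a
    proof -
      obtain x where x: "x \<in> S" "a \<le> x" "\<forall>y\<in>S. \<not> x < y"
        using finite_has_maximal2[OF finS \<open>a \<in> S\<close>] by (auto simp: order.strict_iff_order)
      have rkx: "rkS x = d" using max_rk[OF x(1,3)] de by simp
      have ge: "1 \<le> m y" if "y \<in> V" for y using bal that by (auto simp: balanced_def)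
      have "y \<in> V" if "y \<in> S" "\<phi> y = \<phi> x" for y
        using inV[OF \<open>y \<in> S\<close>] combinatorial_rk[OF gS gD c] that x rkx by (metis le_add1)
      then have "m x \<le> ?M a (\<phi> x)"
        unfolding fibre_mass_def using x finS ge by (intro member_le_sum) force+
      moreover have "1 \<le> m x" using ge inV x rkx by simp
      moreover have "m' a = ?M a (\<phi> x)"
        using m'[OF that, of "\<phi> x"] combinatorial_in[OF c] combinatorial_rk[OF gS gD c]
          combinatorial_mono[OF c that] x rkx by auto
      ultimately show ?thesis by simp
    qed
    have "m' a = (\<Sum>x | x \<in> S \<and> \<phi> x = b \<and> covered_by S a x. m' x)"
      if "a \<in> S" "b \<in> D" and cov: "covered_by D (\<phi> a) b" for a b
    proof -
      note t = top[OF \<open>b \<in> D\<close>]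
      have ab: "\<phi> a \<le> b" using cov by (simp add: covered_by_def order.strict_implies_order)
      have "\<phi> a \<le> top_over b" by (rule order.trans[OF ab]) (use t in blast)
      then have "m' a = ?M a (top_over b)" using m'[OF \<open>a \<in> S\<close>] t by blast
      also have "\<dots> = (\<Sum>x\<in>{x \<in> S. a \<le> x \<and> \<phi> x = b}. ?M x (top_over b))"
        using fibre_mass_decompose[OF c finS \<open>a \<in> S\<close> \<open>b \<in> D\<close> ab] t by blast
      also have "\<dots> = (\<Sum>x\<in>{x \<in> S. a \<le> x \<and> \<phi> x = b}. m' x)"
        by (rule sum.cong) (auto simp: m'_def)
      finally show ?thesis using covers_in_fibre[OF c \<open>a \<in> S\<close> cov] by simp
    qed
    then have "balanced S D \<phi> S m'"
      using pos by (auto simp: balanced_def is_up_set_def)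
    then show ?thesis using ext by blast
  qed
qed

end
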